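(* Let $\mathcal{C}$ be an $[n,k,d]_q$ MDS code of distance $d\ge 5$. Let $\mathcal{V}^{(W)}$ be one of its cosets of weight $W$ with $2\le W\le\lfloor (d-1)/2\rfloor$. Then, in terms of the values $B_v(\mathcal{V}^{(W)})$ with $d-W\le v\le d-2$, the weight distribution of $\mathcal{V}^{(W)}$ is as follows: $$B_w(\mathcal{V}^{(W)})=0\ \text{ if } w\in\{0,1,\ldots,d-W-1\}\setminus\{W\},\qquad B_W(\mathcal{V}^{(W)})=1,$$ $$B_w(\mathcal{V}^{(W)})=A_w(\mathcal{C})-\Omega_w^{(0)}(n,d)+\Omega_w^{(W)}(n,d)+\sum_{v=d-W}^{d-2}\Omega_w^{(v)}(n,d)\,B_v(\mathcal{V}^{(W)})\ \text{ if } w=d-1,d,\ldots,n.$$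
   Context: An $[n,k,d]_q$ code is a $k$-dimensional $\mathbb{F}_q$-linear subspace of $\mathbb{F}_q^n$ with minimum Hamming distance $d$; it is MDS if $d=n-k+1$. A coset of $\mathcal{C}$ is a translate $\mathcal{C}+\mathbf{v}$, $\mathbf{v}\in\mathbb{F}_q^n$; the weight of a coset is the smallest Hamming weight of a vector in it. $A_w(\mathcal{C})$ is the number of codewords of Hamming weight $w$ in $\mathcal{C}$, and $B_w(\mathcal{V})$ is the number of vectors of Hamming weight $w$ in the coset $\mathcal{V}$. Notation: $\Omega_w^{(v)}(n,d)=(-1)^{w-d}\binom{n-v}{w-v}\binom{w-1-v}{d-2-v}$. *)

theory Defs
  imports "HOL-Analysis.Analysis"
begin

text \<open>
  The ambient space \<open>F\<^sub>q\<^sup>n\<close> is \<open>'q ^ 'n\<close>, where \<open>'q\<close> is a finite field type with \<open>q = CARD('q)\<close>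
  and \<open>n = CARD('n)\<close>. Subspaces and dimension over \<open>'q\<close> are \<open>vec.subspace\<close> and \<open>vec.dim\<close>
  (scalar multiplication \<open>*s\<close>), not the real vector space notions \<open>subspace\<close> and \<open>dim\<close>.
\<close>

definition hamming_dist :: "'q ^ 'n \<Rightarrow> 'q ^ 'n \<Rightarrow> nat" where
  "hamming_dist x y = card {i. x $ i \<noteq> y $ i}"

definition hamming_weight :: "'q::zero ^ 'n \<Rightarrow> nat" where
  "hamming_weight x = card {i. x $ i \<noteq> 0}"

text \<open>A relation rather than a function: a code with at most one word has no minimum distance.\<close>

definition has_min_distance :: "('q ^ 'n) set \<Rightarrow> nat \<Rightarrow> bool" where
  "has_min_distance C d \<longleftrightarrow>
     (\<exists>x\<in>C. \<exists>y\<in>C. x \<noteq> y \<and> hamming_dist x y = d) \<and>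
     (\<forall>x\<in>C. \<forall>y\<in>C. x \<noteq> y \<longrightarrow> d \<le> hamming_dist x y)"

definition linear_code :: "nat \<Rightarrow> nat \<Rightarrow> nat \<Rightarrow> nat \<Rightarrow> ('q::{field,finite} ^ 'n) set \<Rightarrow> bool" where
  "linear_code q n k d C \<longleftrightarrow>
     q = CARD('q) \<and> n = CARD('n) \<and> vec.subspace C \<and> vec.dim C = k \<and> has_min_distance C d"

text \<open>The equation \<open>d = n - k + 1\<close> is stated without truncated subtraction.\<close>

definition mds_code :: "nat \<Rightarrow> nat \<Rightarrow> nat \<Rightarrow> nat \<Rightarrow> ('q::{field,finite} ^ 'n) set \<Rightarrow> bool" where
  "mds_code q n k d C \<longleftrightarrow> linear_code q n k d C \<and> int d = int n - int k + 1"

definition is_coset :: "('q::{field,finite} ^ 'n) set \<Rightarrow> ('q ^ 'n) set \<Rightarrow> bool" where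
  "is_coset C V \<longleftrightarrow> (\<exists>v. V = (\<lambda>c. c + v) ` C)"

definition coset_weight :: "('q::{field,finite} ^ 'n) set \<Rightarrow> nat" where
  "coset_weight V = Min (hamming_weight ` V)"

text \<open>For a code \<open>C\<close>, \<open>weight_count C w\<close> is \<open>A\<^sub>w(C)\<close>; for a coset \<open>V\<close>, \<open>weight_count V w\<close> is \<open>B\<^sub>w(V)\<close>.\<close>

definition weight_count :: "('q::{field,finite} ^ 'n) set \<Rightarrow> nat \<Rightarrow> nat" where
  "weight_count V w = card {x \<in> V. hamming_weight x = w}"

text \<open>
  \<open>Omega n d v w\<close> is \<open>\<Omega>\<^sub>w\<^sup>(\<^sup>v\<^sup>)(n,d)\<close>. The integer exponent matters at \<open>w = d - 1\<close>, where the sign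
  is \<open>(-1)\<^sup>-\<^sup>1\<close>. The subtractions inside the binomial coefficients are on natural numbers and are
  exact whenever \<open>v \<le> d - 2\<close> and \<open>d - 1 \<le> w\<close> (with \<open>2 \<le> d\<close> and \<open>v \<le> n\<close>).
\<close>

definition Omega :: "nat \<Rightarrow> nat \<Rightarrow> nat \<Rightarrow> nat \<Rightarrow> real" where
  "Omega n d v w =
     (-1) powi (int w - int d) * real ((n - v) choose (w - v)) * real ((w - 1 - v) choose (d - 2 - v))"

end

theory Submission
  imports Defs
begin

text \<open>
  Every coset of an MDS code meets the space of vectors supported on a set \<open>T\<close> of at least \<open>d - 1\<close>
  coordinates in as many vectors as the code does. Summing over all \<open>T\<close> of size \<open>t\<close> shows that the
  differences \<open>D\<^sub>w = B\<^sub>w - A\<^sub>w\<close> satisfy \<open>\<Sum>w\<le>t. (n - w choose t - w) D\<^sub>w = 0\<close> for \<open>d - 1 \<le> t \<le> n\<close>. This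
  triangular system expresses all \<open>D\<^sub>w\<close> through those with index at most \<open>d - 2\<close>, and the coefficients
  are the \<open>\<Omega>\<close>. In the given weight range only \<open>D\<^sub>0 = -1\<close>, \<open>D\<^sub>W = 1\<close> and \<open>D\<^sub>v = B\<^sub>v\<close> with
  \<open>d - W \<le> v \<le> d - 2\<close> can be nonzero, because two vectors of a coset differ by a codeword.
\<close>

section \<open>Binomial identities behind \<open>Omega\<close>\<close>

text \<open>Pulling out \<open>m choose a\<close> by \<open>choose_mult\<close> leaves the full
  alternating row sum of Pascal's triangle for \<open>m - a\<close>, which vanishes unless
  \<open>m = a\<close>.\<close>

lemma sum_alternating_choose_mult:
  "(\<Sum>i = a..m. (-1) ^ (i - a) * real (m choose i) * real (i choose a)) = (if m = a then 1 else 0)"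
proof (cases "m \<le> a")
  case False
  then have "a \<le> m" "m - a > 0" by auto
  have "(\<Sum>i = a..m. (-1) ^ (i - a) * real (m choose i) * real (i choose a))
      = (\<Sum>i = a..m. (-1) ^ (i - a) * real ((m - a) choose (i - a)) * real (m choose a))"
    using choose_mult[of a _ m] by (intro sum.cong) (simp_all flip: of_nat_mult add: mult.assoc mult.commute)
  also have "\<dots> = (\<Sum>i\<le>m - a. (-1) ^ i * real ((m - a) choose i) * real (m choose a))"
    by (rule sum.reindex_bij_witness[of _ "\<lambda>i. i + a" "\<lambda>i. i - a"]) (use \<open>a \<le> m\<close> in auto)
  also have "\<dots> = 0"
    using choose_alternating_sum[OF \<open>m - a > 0\<close>, where 'a = real] by (simp flip: sum_distrib_right)
  finally show ?thesis using False by auto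
qed auto

text \<open>Pascal's rule on \<open>Suc m choose Suc i\<close> turns the increment from
  \<open>m\<close> to \<open>Suc m\<close> into the previous sum. So the value jumps from 0 to 1 at
  \<open>m = Suc a\<close> and stays there.\<close>

lemma sum_alternating_choose_mult_pred:
  assumes "a < m"
  shows "(\<Sum>j = Suc a..m. (-1) ^ (j - Suc a) * real (m choose j) * real ((j - 1) choose a)) = 1"
proof -
  define f where "f m = (\<Sum>j = Suc a..m. (-1) ^ (j - Suc a) * real (m choose j) * real ((j - 1) choose a))" for m
  have step: "f (Suc m) = f m + (if m = a then 1 else 0)" if "a \<le> m" for m
  proof -
    have "f (Suc m) = (\<Sum>i = a..m. (-1) ^ (i - a) * real (Suc m choose Suc i) * real (i choose a))"
      unfolding f_def by (subst sum.shift_bounds_cl_Suc_ivl) simp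
    also have "\<dots> = (\<Sum>i = a..m. (-1) ^ (i - a) * real (m choose Suc i) * real (i choose a))
        + (\<Sum>i = a..m. (-1) ^ (i - a) * real (m choose i) * real (i choose a))"
      by (simp add: algebra_simps sum.distrib)
    also have "(\<Sum>i = a..m. (-1) ^ (i - a) * real (m choose Suc i) * real (i choose a))
        = (\<Sum>j = Suc a..Suc m. (-1) ^ (j - Suc a) * real (m choose j) * real ((j - 1) choose a))"
      by (subst sum.shift_bounds_cl_Suc_ivl) simp
    also have "\<dots> = f m"
      using that by (simp add: f_def)
    finally show ?thesis by (simp add: sum_alternating_choose_mult)
  qed
  have "f m = 1"
    using Suc_leI[OF assms]
  proof (induction m rule: dec_induct)
    case base
    have "f a = 0" by (simp add: f_def)
    then show ?case using step[of a] by simp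
  qed (use step in auto)
  then show ?thesis by (simp add: f_def)
qed

text \<open>This makes \<open>Omega n d v\<close> a fundamental solution of the moment equations:
  prescribing 1 at index \<open>v\<close> and 0 at the other indices below \<open>d - 1\<close>
  forces the value \<open>Omega n d v w\<close> at each \<open>w\<close> from \<open>d - 1\<close>
  to \<open>n\<close>.\<close>

lemma sum_choose_mult_Omega:
  assumes "2 \<le> d" "v \<le> d - 2" "d - 1 \<le> t" "t \<le> n"
  shows "(\<Sum>w = d - 1..t. real ((n - w) choose (t - w)) * Omega n d v w) = - real ((n - v) choose (t - v))"
proof -
  define a where "a = d - 2 - v"
  have d: "d = a + v + 2" using assms by (simp add: a_def)
  have "real ((n - w) choose (t - w)) * Omega n d v w
      = - (real ((n - v) choose (t - v)) * ((-1) ^ (w - v - Suc a) * real ((t - v) choose (w - v)) * real ((w - v - 1) choose a)))"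
    if "w \<in> {d - 1..t}" for w
  proof -
    have w: "Suc (a + v) \<le> w" "w \<le> t" using that d by auto
    \<comment> \<open>The exponent \<open>w - d\<close> is -1 at \<open>w = d - 1\<close>. Shifting
      it by one gives a natural exponent and produces the overall minus sign.\<close>
    define e where "e = w - v - Suc a"
    have "w = e + a + v + 1" using w by (simp add: e_def)
    then have "int w - int d = int e - 1" using d by simp
    then have sgn: "(-1 :: real) powi (int w - int d) = - ((-1) ^ e)"
      by (simp add: power_int_diff)
    \<comment> \<open>This isolates a factor free of \<open>w\<close>; the remaining sum is the
      preceding lemma with \<open>m = t - v\<close> and \<open>j = w - v\<close>.\<close>
    have "((n - v) choose (w - v)) * ((n - w) choose (t - w)) = ((n - v) choose (t - v)) * ((t - v) choose (w - v))"
      using choose_mult[of "w - v" "t - v" "n - v"] w assms by (simp add: mult.commute)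
    then have "real ((n - v) choose (w - v)) * real ((n - w) choose (t - w)) * x
        = real ((n - v) choose (t - v)) * real ((t - v) choose (w - v)) * x" for x
      by (simp flip: of_nat_mult)
    from this[of "(-1) ^ e * real ((w - v - 1) choose a)"]
    have "real ((n - w) choose (t - w)) * ((-1) ^ e * real ((n - v) choose (w - v)) * real ((w - v - 1) choose a))
        = real ((n - v) choose (t - v)) * ((-1) ^ e * real ((t - v) choose (w - v)) * real ((w - v - 1) choose a))"
      by (simp only: mult_ac)
    then show ?thesis
      unfolding Omega_def sgn a_def[symmetric] e_def[symmetric] diff_commute[of w 1 v] by simp
  qed
  then have "(\<Sum>w = d - 1..t. real ((n - w) choose (t - w)) * Omega n d v w)
      = - (real ((n - v) choose (t - v)) * (\<Sum>w = d - 1..t. (-1) ^ (w - v - Suc a) * real ((t - v) choose (w - v)) * real ((w - v - 1) choose a)))"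
    by (simp add: sum_negf sum_distrib_left)
  also have "(\<Sum>w = d - 1..t. (-1) ^ (w - v - Suc a) * real ((t - v) choose (w - v)) * real ((w - v - 1) choose a))
      = (\<Sum>j = Suc a..t - v. (-1) ^ (j - Suc a) * real ((t - v) choose j) * real ((j - 1) choose a))"
    by (rule sum.reindex_bij_witness[of _ "\<lambda>j. j + v" "\<lambda>w. w - v"]) (use d assms in auto)
  also have "\<dots> = 1"
    by (rule sum_alternating_choose_mult_pred) (use d assms in auto)
  finally show ?thesis by simp
qed

section \<open>Solving the triangular system\<close>

text \<open>In the equation for \<open>t\<close> the unknown \<open>D t\<close> has coefficient 1.
  Substituting the induction hypothesis and swapping sums, the direct contributions of the
  \<open>D v\<close> cancel and only the \<open>Omega\<close> terms remain.\<close>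

lemma binomial_moments_zero_imp_Omega_expansion:
  fixes D :: "nat \<Rightarrow> real"
  assumes "2 \<le> d"
    and moments: "\<And>t. t \<in> {d - 1..n} \<Longrightarrow> (\<Sum>w\<le>t. real ((n - w) choose (t - w)) * D w) = 0"
    and "t \<in> {d - 1..n}"
  shows "D t = (\<Sum>v\<le>d - 2. Omega n d v t * D v)"
  using \<open>t \<in> {d - 1..n}\<close>
proof (induction t rule: less_induct)
  case (less t)
  let ?c = "\<lambda>w. real ((n - w) choose (t - w))"
  have t: "d - 1 \<le> t" "t \<le> n" using less.prems by auto
  have "{..t} = {..d - 2} \<union> {d - 1..<t} \<union> {t}" using t \<open>2 \<le> d\<close> by auto
  then have "0 = (\<Sum>w\<in>{..d - 2} \<union> {d - 1..<t} \<union> {t}. ?c w * D w)"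
    using moments[OF less.prems] by simp
  also have "\<dots> = (\<Sum>v\<le>d - 2. ?c v * D v) + (\<Sum>w = d - 1..<t. ?c w * D w) + D t"
    using t \<open>2 \<le> d\<close> by (subst sum.union_disjoint; (subst sum.union_disjoint)?) auto
  also have "(\<Sum>w = d - 1..<t. ?c w * D w) = (\<Sum>w = d - 1..<t. ?c w * (\<Sum>v\<le>d - 2. Omega n d v w * D v))"
    by (intro sum.cong) (use less.IH t in auto)
  also have "\<dots> = (\<Sum>w = d - 1..<t. \<Sum>v\<le>d - 2. D v * (?c w * Omega n d v w))"
    by (simp add: sum_distrib_left algebra_simps)
  also have "\<dots> = (\<Sum>v\<le>d - 2. D v * (\<Sum>w = d - 1..<t. ?c w * Omega n d v w))"
    unfolding sum_distrib_left by (rule sum.swap)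
  also have "\<dots> = (\<Sum>v\<le>d - 2. - (?c v * D v) - Omega n d v t * D v)"
  proof (intro sum.cong refl)
    fix v assume "v \<in> {..d - 2}"
    have "{d - 1..t} = insert t {d - 1..<t}" using t by auto
    then have "(\<Sum>w = d - 1..t. ?c w * Omega n d v w) = Omega n d v t + (\<Sum>w = d - 1..<t. ?c w * Omega n d v w)"
      by simp
    then have "(\<Sum>w = d - 1..<t. ?c w * Omega n d v w) = - ?c v - Omega n d v t"
      using sum_choose_mult_Omega[of d v t n] \<open>2 \<le> d\<close> \<open>v \<in> _\<close> t by simp
    then show "D v * (\<Sum>w = d - 1..<t. ?c w * Omega n d v w) = - (?c v * D v) - Omega n d v t * D v"
      by (simp only: right_diff_distrib mult_minus_right mult.commute[of "D v"])
  qed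
  finally show ?case by (simp add: sum_subtractf sum_negf)
qed

section \<open>Counting vectors by their supports\<close>

lemma card_supersets:
  assumes "finite A" "S \<subseteq> A" "card S \<le> t"
  shows "card {T. S \<subseteq> T \<and> T \<subseteq> A \<and> card T = t} = (card A - card S) choose (t - card S)"
proof -
  have fin: "finite S" "finite T" if "T \<subseteq> A" for T
    using that assms finite_subset by auto
  have "bij_betw (\<lambda>T. T - S) {T. S \<subseteq> T \<and> T \<subseteq> A \<and> card T = t} {B. B \<subseteq> A - S \<and> card B = t - card S}"
  proof (rule bij_betw_byWitness[where f' = "\<lambda>B. B \<union> S"])
    show "(\<lambda>T. T - S) ` {T. S \<subseteq> T \<and> T \<subseteq> A \<and> card T = t} \<subseteq> {B. B \<subseteq> A - S \<and> card B = t - card S}"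
      using fin by (auto simp: card_Diff_subset)
    show "(\<lambda>B. B \<union> S) ` {B. B \<subseteq> A - S \<and> card B = t - card S} \<subseteq> {T. S \<subseteq> T \<and> T \<subseteq> A \<and> card T = t}"
    proof clarsimp
      fix B assume B: "B \<subseteq> A - S" "card B = t - card S"
      then have "card (B \<union> S) = card B + card S"
        using fin[of B] by (intro card_Un_disjoint) auto
      then show "B \<subseteq> A \<and> S \<subseteq> A \<and> card (B \<union> S) = t"
        using B assms by auto
    qed
  qed auto
  then have "card {T. S \<subseteq> T \<and> T \<subseteq> A \<and> card T = t} = card (A - S) choose (t - card S)"
    using \<open>finite A\<close> by (simp add: bij_betw_same_card n_subsets)
  then show ?thesis using assms fin[of S] by (simp add: card_Diff_subset)
qed

text \<open>Double counting of pairs of a vector and a \<open>t\<close>-set containing its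
  support.\<close>

lemma sum_card_support_subset:
  fixes V :: "('q::{field,finite} ^ 'n) set"
  shows "(\<Sum>T | card T = t. card {x \<in> V. {i. x $ i \<noteq> 0} \<subseteq> T})
    = (\<Sum>w\<le>t. ((CARD('n) - w) choose (t - w)) * weight_count V w)"
proof -
  let ?s = "\<lambda>x :: 'q ^ 'n. {i. x $ i \<noteq> 0}"
  let ?c = "\<lambda>w. (CARD('n) - w) choose (t - w)"
  have "(\<Sum>T | card T = t. card {x \<in> V. ?s x \<subseteq> T}) = (\<Sum>x\<in>V. card {T. card T = t \<and> ?s x \<subseteq> T})"
    using sum.swap_restrict[of "{T :: 'n set. card T = t}" V "\<lambda>_ _. 1::nat" "\<lambda>T x. ?s x \<subseteq> T"] by simp
  \<comment> \<open>The case split is needed: for weight above \<open>t\<close>, truncated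
    \<open>t - w\<close> would give coefficient 1, but no \<open>t\<close>-set contains the
    support.\<close>
  also have "\<dots> = (\<Sum>x\<in>V. if hamming_weight x \<le> t then ?c (hamming_weight x) else 0)"
  proof (intro sum.cong refl)
    fix x :: "'q ^ 'n"
    have "{T. card T = t \<and> ?s x \<subseteq> T} = {}" if "\<not> hamming_weight x \<le> t"
      using that card_mono[of _ "?s x"] by (auto simp: hamming_weight_def)
    moreover have "{T. card T = t \<and> ?s x \<subseteq> T} = {T. ?s x \<subseteq> T \<and> T \<subseteq> UNIV \<and> card T = t}" by auto
    ultimately show "card {T. card T = t \<and> ?s x \<subseteq> T} = (if hamming_weight x \<le> t then ?c (hamming_weight x) else 0)"
      using card_supersets[of UNIV "?s x" t] by (auto simp: hamming_weight_def)
  qed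
  also have "\<dots> = (\<Sum>x\<in>{x \<in> V. hamming_weight x \<le> t}. ?c (hamming_weight x))"
    by (rule sum.inter_filter[symmetric]) simp
  also have "\<dots> = (\<Sum>w\<le>t. \<Sum>x\<in>{x \<in> {x \<in> V. hamming_weight x \<le> t}. hamming_weight x = w}. ?c (hamming_weight x))"
    by (rule sum.group[symmetric]) auto
  also have "\<dots> = (\<Sum>w\<le>t. ?c w * weight_count V w)"
  proof (intro sum.cong refl)
    fix w assume "w \<in> {..t}"
    then have "{x \<in> {x \<in> V. hamming_weight x \<le> t}. hamming_weight x = w} = {x \<in> V. hamming_weight x = w}"
      by auto
    then show "(\<Sum>x\<in>{x \<in> {x \<in> V. hamming_weight x \<le> t}. hamming_weight x = w}. ?c (hamming_weight x)) = ?c w * weight_count V w"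
      by (simp add: weight_count_def)
  qed
  finally show ?thesis .
qed

section \<open>Linear codes, MDS codes and their cosets\<close>

lemma hamming_dist_eq_weight_diff:
  fixes x y :: "'q::{field,finite} ^ 'n"
  shows "hamming_dist x y = hamming_weight (x - y)"
  by (simp add: hamming_dist_def hamming_weight_def)

lemma hamming_weight_diff_le:
  fixes x y :: "'q::{field,finite} ^ 'n"
  shows "hamming_weight (x - y) \<le> hamming_weight x + hamming_weight y"
proof -
  have "card {i. (x - y) $ i \<noteq> 0} \<le> card ({i. x $ i \<noteq> 0} \<union> {i. y $ i \<noteq> 0})"
    by (intro card_mono) auto
  also have "\<dots> \<le> card {i. x $ i \<noteq> 0} + card {i. y $ i \<noteq> 0}" by (rule card_Un_le)
  finally show ?thesis by (simp add: hamming_weight_def)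
qed

lemma hamming_weight_eq_0_iff:
  fixes x :: "'q::{field,finite} ^ 'n"
  shows "hamming_weight x = 0 \<longleftrightarrow> x = 0"
  by (auto simp: hamming_weight_def vec_eq_iff)

lemma linear_code_weight_ge:
  assumes "linear_code q n k d C" "c \<in> C" "c \<noteq> 0"
  shows "d \<le> hamming_weight c"
proof -
  have "0 \<in> C" using assms(1) vec.subspace_0 by (auto simp: linear_code_def)
  then have "d \<le> hamming_dist c 0"
    using assms by (auto simp: linear_code_def has_min_distance_def)
  then show ?thesis by (simp add: hamming_dist_eq_weight_diff)
qed

text \<open>An MDS code is complementary to the space of vectors supported on any \<open>d - 1\<close> coordinates:
  they intersect trivially, and their dimensions add up to \<open>n\<close>.\<close>

lemma mds_coset_has_vector_supported_on:
  fixes C V :: "('q::{field,finite} ^ 'n) set"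
  assumes mds: "mds_code q n k d C" and "is_coset C V" and "d - 1 \<le> card T"
  shows "\<exists>u\<in>V. {i. u $ i \<noteq> 0} \<subseteq> T"
proof -
  have code: "linear_code q n k d C" and C: "vec.subspace C" and k: "vec.dim C = k"
    and n: "n = CARD('n)" and d: "int d = int n - int k + 1"
    using mds by (auto simp: mds_code_def linear_code_def)
  obtain v where V: "V = (\<lambda>c. c + v) ` C" using \<open>is_coset C V\<close> by (auto simp: is_coset_def)
  \<comment> \<open>Exactly \<open>d - 1\<close> coordinates are kept, so that the dimensions
    \<open>k\<close> and \<open>d - 1\<close> sum to \<open>n\<close>.\<close>
  obtain S where S: "S \<subseteq> T" "card S = d - 1"
    using \<open>d - 1 \<le> card T\<close> by (meson obtain_subset_with_card_n)
  define U where "U = {x :: 'q ^ 'n. \<forall>i. i \<notin> S \<longrightarrow> x $ i = 0}"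
  have U: "vec.subspace U" by (auto simp: U_def vec.subspace_def)
  have "k \<le> n" using vec.dim_subset[of C UNIV] k n by (simp only: vec_dim_card subset_UNIV)
  have "x = 0" if "x \<in> C" "x \<in> U" for x
  proof (rule ccontr)
    assume "x \<noteq> 0"
    then have "d \<le> hamming_weight x" using linear_code_weight_ge code that by blast
    moreover have "hamming_weight x \<le> card S"
      unfolding hamming_weight_def by (intro card_mono) (use that in \<open>auto simp: U_def\<close>)
    ultimately show False using S d \<open>k \<le> n\<close> by simp
  qed
  then have "vec.dim (C \<inter> U) = 0" by (subst vec.dim_eq_0) auto
  moreover have "vec.dim U = card S" unfolding U_def by (rule dim_substandard_cart)
  ultimately have "vec.dim {x + y |x y. x \<in> C \<and> y \<in> U} = CARD('n)"
    using vec.dim_sums_Int[OF C U] S k n d \<open>k \<le> n\<close> by linarith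
  then have "vec.span {x + y |x y. x \<in> C \<and> y \<in> U} = UNIV"
    using vec.dim_eq_span[of "{x + y |x y. x \<in> C \<and> y \<in> U}" UNIV] by (simp only: vec_dim_card subset_UNIV vec.span_UNIV order_refl)
  moreover have "vec.span {x + y |x y. x \<in> C \<and> y \<in> U} = {x + y |x y. x \<in> C \<and> y \<in> U}"
    using vec.subspace_sums[OF C U] by (simp add: vec.span_eq_iff)
  \<comment> \<open>Removing the code component of the representative \<open>v\<close> stays in the
    coset and leaves a vector supported on \<open>S\<close>.\<close>
  ultimately obtain c u where cu: "v = c + u" "c \<in> C" "u \<in> U" by blast
  then have "u = - c + v" by simp
  then have "u \<in> V" using V cu vec.subspace_neg[OF C] by blast
  then show ?thesis using cu S by (auto simp: U_def)
qed

lemma coset_diff_mem: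
  assumes "linear_code q n k d C" "is_coset C V" "x \<in> V" "y \<in> V"
  shows "x - y \<in> C"
  using assms vec.subspace_diff[of C] by (auto simp: linear_code_def is_coset_def)

lemma coset_add_mem:
  assumes "linear_code q n k d C" "is_coset C V" "x \<in> V" "c \<in> C"
  shows "c + x \<in> V"
  using assms vec.subspace_add[of C] by (auto simp: linear_code_def is_coset_def simp flip: add.assoc)

text \<open>Translation by a coset vector supported on \<open>T\<close> is a bijection; the MDS
  property supplies such a vector.\<close>

lemma mds_coset_card_support_subset:
  fixes C V :: "('q::{field,finite} ^ 'n) set"
  assumes mds: "mds_code q n k d C" and coset: "is_coset C V" and "d - 1 \<le> card T"
  shows "card {x \<in> V. {i. x $ i \<noteq> 0} \<subseteq> T} = card {x \<in> C. {i. x $ i \<noteq> 0} \<subseteq> T}"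
proof -
  have code: "linear_code q n k d C" using mds by (simp add: mds_code_def)
  obtain u where u: "u \<in> V" "{i. u $ i \<noteq> 0} \<subseteq> T"
    using mds_coset_has_vector_supported_on[OF assms] by blast
  have "bij_betw (\<lambda>c. c + u) {x \<in> C. {i. x $ i \<noteq> 0} \<subseteq> T} {x \<in> V. {i. x $ i \<noteq> 0} \<subseteq> T}"
  proof (rule bij_betw_byWitness[where f' = "\<lambda>x. x - u"])
    show "(\<lambda>c. c + u) ` {x \<in> C. {i. x $ i \<noteq> 0} \<subseteq> T} \<subseteq> {x \<in> V. {i. x $ i \<noteq> 0} \<subseteq> T}"
      using coset_add_mem[OF code coset u(1)] u(2) by force
    show "(\<lambda>x. x - u) ` {x \<in> V. {i. x $ i \<noteq> 0} \<subseteq> T} \<subseteq> {x \<in> C. {i. x $ i \<noteq> 0} \<subseteq> T}"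
      using coset_diff_mem[OF code coset _ u(1)] u(2) by force
  qed auto
  then show ?thesis by (simp add: bij_betw_same_card)
qed

section \<open>Weight distribution of a low-weight coset\<close>

theorem theorem4p4:
  fixes C V :: "('q::{field,finite} ^ 'n) set"
    and q n k d W :: nat
  assumes "mds_code q n k d C"
    and "d \<ge> 5"
    and "is_coset C V"
    and "coset_weight V = W"
    and "2 \<le> W"
    and "int W \<le> \<lfloor>(real d - 1) / 2\<rfloor>"
  shows "(\<forall>w \<in> {0..d - W - 1} - {W}. weight_count V w = 0)
    \<and> weight_count V W = 1
    \<and> (\<forall>w \<in> {d - 1..n}. real (weight_count V w) =
          real (weight_count C w) - Omega n d 0 w + Omega n d W w
          + (\<Sum>v = d - W..d - 2. Omega n d v w * real (weight_count V v)))"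
proof -
  have code: "linear_code q n k d C" and C: "vec.subspace C" and n: "n = CARD('n)"
    using assms(1) by (auto simp: mds_code_def linear_code_def)
  have "real W \<le> (real d - 1) / 2" using assms(6) by (simp add: le_floor_iff)
  then have dW: "2 * W < d" by (simp add: field_simps flip: of_nat_less_iff[where 'a = real])
  have "0 \<in> C" using C by (rule vec.subspace_0)
  then have "V \<noteq> {}" using \<open>is_coset C V\<close> by (auto simp: is_coset_def)
  then have "W \<in> hamming_weight ` V"
    using \<open>coset_weight V = W\<close> Min_in[of "hamming_weight ` V"] by (simp add: coset_weight_def)
  then obtain e where e: "e \<in> V" "hamming_weight e = W" by blast
  \<comment> \<open>Otherwise \<open>x - e\<close> would be a nonzero codeword of weight below
    \<open>d\<close>. Since \<open>2 * W < d\<close>, this covers weight \<open>W\<close>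
    itself.\<close>
  have e_unique: "x = e" if "x \<in> V" "hamming_weight x + W < d" for x
  proof (rule ccontr)
    assume "x \<noteq> e"
    then have "d \<le> hamming_weight (x - e)"
      using coset_diff_mem[OF code assms(3) that(1) e(1)] linear_code_weight_ge[OF code] by simp
    then show False using hamming_weight_diff_le[of x e] that e by simp
  qed
  have B0: "weight_count V w = 0" if "w \<in> {0..d - W - 1} - {W}" for w
  proof -
    have "w + W < d" "w \<noteq> W" using that dW by auto
    then have "hamming_weight x \<noteq> w" if "x \<in> V" for x
      using e_unique[OF that] e(2) by auto
    then show ?thesis by (simp add: weight_count_def)
  qed
  have "{x \<in> V. hamming_weight x = W} = {e}"
  proof (intro equalityI subsetI)
    fix x assume "x \<in> {x \<in> V. hamming_weight x = W}"
    then show "x \<in> {e}" using e_unique[of x] dW by simp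
  qed (use e in simp)
  then have BW: "weight_count V W = 1" by (simp add: weight_count_def)
  have "{x \<in> C. hamming_weight x = 0} = {0}" using \<open>0 \<in> C\<close> by (auto simp: hamming_weight_eq_0_iff)
  then have A0: "weight_count C 0 = 1" by (simp add: weight_count_def)
  have A: "weight_count C w = 0" if "0 < w" "w < d" for w
  proof -
    have "hamming_weight x \<noteq> w" if "x \<in> C" for x
      using linear_code_weight_ge[OF code that] hamming_weight_eq_0_iff[of x] \<open>0 < w\<close> \<open>w < d\<close>
      by (cases "x = 0") auto
    then show ?thesis by (simp add: weight_count_def)
  qed
  define D where "D w = real (weight_count V w) - real (weight_count C w)" for w
  have moments: "(\<Sum>w\<le>t. real ((n - w) choose (t - w)) * D w) = 0" if "t \<in> {d - 1..n}" for t
  proof -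
    have "(\<Sum>T :: 'n set | card T = t. card {x \<in> V. {i. x $ i \<noteq> 0} \<subseteq> T})
        = (\<Sum>T | card T = t. card {x \<in> C. {i. x $ i \<noteq> 0} \<subseteq> T})"
      by (intro sum.cong refl mds_coset_card_support_subset[OF assms(1,3)]) (use that in auto)
    then have "real (\<Sum>w\<le>t. ((n - w) choose (t - w)) * weight_count V w)
        = real (\<Sum>w\<le>t. ((n - w) choose (t - w)) * weight_count C w)"
      by (simp only: sum_card_support_subset n)
    then show ?thesis by (simp add: D_def right_diff_distrib sum_subtractf)
  qed
  have "real (weight_count V w) = real (weight_count C w) - Omega n d 0 w + Omega n d W w
      + (\<Sum>v = d - W..d - 2. Omega n d v w * real (weight_count V v))" if w: "w \<in> {d - 1..n}" for w
  proof -
    have "D w = (\<Sum>v\<le>d - 2. Omega n d v w * D v)"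
      using binomial_moments_zero_imp_Omega_expansion[OF _ moments w] \<open>d \<ge> 5\<close> by simp
    \<comment> \<open>At every other index up to \<open>d - 2\<close> both the coset and the code
      have no vectors.\<close>
    also have "\<dots> = (\<Sum>v\<in>{0, W} \<union> {d - W..d - 2}. Omega n d v w * D v)"
      by (rule sum.mono_neutral_right) (use dW \<open>d \<ge> 5\<close> B0 A in \<open>auto simp: D_def\<close>)
    \<comment> \<open>The zero codeword gives \<open>D 0 = -1\<close> and the unique leader
      \<open>e\<close> gives \<open>D W = 1\<close>; \<open>W < d - W\<close> keeps the index sets
      disjoint.\<close>
    also have "\<dots> = - Omega n d 0 w + Omega n d W w + (\<Sum>v = d - W..d - 2. Omega n d v w * D v)"
      using dW \<open>2 \<le> W\<close> B0[of 0] BW A0 A[of W] by (subst sum.union_disjoint) (auto simp: D_def)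
    also have "(\<Sum>v = d - W..d - 2. Omega n d v w * D v) = (\<Sum>v = d - W..d - 2. Omega n d v w * real (weight_count V v))"
      by (intro sum.cong) (use A dW in \<open>auto simp: D_def\<close>)
    finally show ?thesis by (simp add: D_def)
  qed
  then show ?thesis using B0 BW by blast
qed

end
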